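(* The following problem is in $\mathsf{AC}^0$. Input: a binary number $A=(a_0,\ldots,a_{m-1})$ with $a_i\in\{0,1\}$, representing $\sum_{i=0}^{m-1}a_i2^i$. Output: a compact signed-digit representation of $A$, i.e. a compact signed-digit representation $B$ with $\mathrm{val}(B)=\sum_{i=0}^{m-1}a_i2^i$.
   Context: A signed-digit representation is a sequence $B=(b_0,\ldots,b_{m-1})$ with $b_i\in\{-1,0,1\}$; its value is $\mathrm{val}(B)=\sum_{i=0}^{m-1}b_i2^i\in\mathbb{Z}$. It is compact if $b_ib_{i-1}=0$ for all $i\in\{1,\ldots,m-1\}$ (no two successive digits are non-zero). The three digit values $-1,0,1$ are each encoded using two bits. $\mathsf{AC}^0$ is the (non-uniform) class of functions computed by families of polynomial-size, constant-depth circuits with unbounded fan-in And, Or and Not gates. *)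

theory Defs
  imports Main "HOL-Computational_Algebra.Polynomial"
begin

text \<open>
  A circuit is a directed acyclic graph presented in topological order. With \<open>n\<close> inputs, node
  \<open>i < n\<close> is the \<open>i\<close>-th input and node \<open>n + k\<close> is the \<open>k\<close>-th gate, whose predecessors
  are nodes with smaller numbers. The constants true and false are \<open>And []\<close> and \<open>Or []\<close>.
\<close>

datatype gate = Not nat | And "nat list" | Or "nat list"

datatype circuit =
  Circuit (num_inputs: nat) (gates: "gate list") (outputs: "nat list")

fun preds :: "gate \<Rightarrow> nat list" where
  "preds (Not w) = [w]"
| "preds (And ws) = ws"
| "preds (Or ws) = ws"

definition wf_circuit :: "circuit \<Rightarrow> bool" where
  "wf_circuit C \<longleftrightarrow>
     (\<forall>k < length (gates C). \<forall>w \<in> set (preds (gates C ! k)). w < num_inputs C + k) \<and>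
     (\<forall>w \<in> set (outputs C). w < num_inputs C + length (gates C))"

fun eval_gate :: "bool list \<Rightarrow> gate \<Rightarrow> bool" where
  "eval_gate vs (Not w) = (\<not> vs ! w)"
| "eval_gate vs (And ws) = (\<forall>w \<in> set ws. vs ! w)"
| "eval_gate vs (Or ws) = (\<exists>w \<in> set ws. vs ! w)"

definition node_values :: "circuit \<Rightarrow> bool list \<Rightarrow> bool list" where
  "node_values C x = foldl (\<lambda>vs g. vs @ [eval_gate vs g]) x (gates C)"

definition eval_circuit :: "circuit \<Rightarrow> bool list \<Rightarrow> bool list" where
  "eval_circuit C x = map ((!) (node_values C x)) (outputs C)"

text \<open>
  Predecessor lists may contain repetitions, so edges and output pins are counted as well as gates.
\<close>

definition circuit_size :: "circuit \<Rightarrow> nat" where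
  "circuit_size C =
     length (gates C) + (\<Sum>g \<leftarrow> gates C. length (preds g)) + length (outputs C)"

definition node_depths :: "circuit \<Rightarrow> nat list" where
  "node_depths C =
     foldl (\<lambda>ds g. ds @ [Suc (Max (insert 0 ((!) ds ` set (preds g))))])
       (replicate (num_inputs C) 0) (gates C)"

definition circuit_depth :: "circuit \<Rightarrow> nat" where
  "circuit_depth C = Max (insert 0 (set (node_depths C)))"

text \<open>
  The circuit family is an arbitrary function of the input length (non-uniformity).
  The length of \<open>f x\<close> necessarily depends only on the length of \<open>x\<close>.
\<close>

definition AC0 :: "(bool list \<Rightarrow> bool list) set" where
  "AC0 = {f. \<exists>(C :: nat \<Rightarrow> circuit) (p :: nat poly) (d :: nat). \<forall>n.
      wf_circuit (C n) \<and> num_inputs (C n) = n \<and>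
      circuit_size (C n) \<le> poly p n \<and> circuit_depth (C n) \<le> d \<and>
      (\<forall>x. length x = n \<longrightarrow> eval_circuit (C n) x = f x)}"

text \<open>
  A problem relates an input to its admissible outputs, of which there may be several; solving it
  means computing some function that always returns an admissible output.
\<close>

definition problem_in_AC0 :: "(bool list \<Rightarrow> bool list \<Rightarrow> bool) \<Rightarrow> bool" where
  "problem_in_AC0 R \<longleftrightarrow> (\<exists>f \<in> AC0. \<forall>x. R x (f x))"

definition bin_val :: "bool list \<Rightarrow> int" where
  "bin_val A = (\<Sum>i < length A. of_bool (A ! i) * 2 ^ i)"

definition signed_digit_rep :: "int list \<Rightarrow> bool" where
  "signed_digit_rep B \<longleftrightarrow> set B \<subseteq> {-1, 0, 1}"

definition sd_val :: "int list \<Rightarrow> int" where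
  "sd_val B = (\<Sum>i < length B. B ! i * 2 ^ i)"

definition compact_rep :: "int list \<Rightarrow> bool" where
  "compact_rep B \<longleftrightarrow> (\<forall>i \<in> {1..<length B}. B ! i * B ! (i - 1) = 0)"

definition encode_digits :: "(int \<Rightarrow> bool \<times> bool) \<Rightarrow> int list \<Rightarrow> bool list" where
  "encode_digits enc B = concat (map (\<lambda>b. [fst (enc b), snd (enc b)]) B)"

text \<open>
  The number of digits of the output is not prescribed: it need not equal the number of input bits
  (for instance \<open>3 = 4 - 1\<close> has two bits, but needs three digits in compact form).
\<close>

definition compact_sd_problem ::
    "(int \<Rightarrow> bool \<times> bool) \<Rightarrow> bool list \<Rightarrow> bool list \<Rightarrow> bool" where
  "compact_sd_problem enc A y \<longleftrightarrow>
     (\<exists>B. signed_digit_rep B \<and> compact_rep B \<and> sd_val B = bin_val A \<and>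
          y = encode_digits enc B)"

end

theory Submission imports Defs begin

text \<open>
  Let \<open>c\<^sub>0 = 0\<close> and let \<open>c\<^sub>i\<^sub>+\<^sub>1\<close> be the majority of \<open>a\<^sub>i\<close>, \<open>a\<^sub>i\<^sub>+\<^sub>1\<close> and \<open>c\<^sub>i\<close>. The digits
  \<open>b\<^sub>i = a\<^sub>i + c\<^sub>i - 2 c\<^sub>i\<^sub>+\<^sub>1\<close> have the same value as the \<open>a\<^sub>i\<close> by telescoping, and if
  \<open>b\<^sub>i \<noteq> 0\<close> then \<open>a\<^sub>i \<noteq> c\<^sub>i\<close>, so \<open>c\<^sub>i\<^sub>+\<^sub>1 = a\<^sub>i\<^sub>+\<^sub>1\<close> and \<open>b\<^sub>i\<^sub>+\<^sub>1 = 0\<close>. As in carry-lookahead addition, \<open>c\<^sub>i\<close>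
  is computed in constant depth: some position \<open>j < i\<close> generates a carry
  (\<open>a\<^sub>j = a\<^sub>j\<^sub>+\<^sub>1 = 1\<close>) that every position \<open>k\<close> strictly between \<open>j\<close> and \<open>i\<close> propagates
  (\<open>a\<^sub>k = 1\<close> or \<open>a\<^sub>k\<^sub>+\<^sub>1 = 1\<close>).
\<close>

section \<open>Building constant-depth circuits\<close>

abbreviation gate_values :: "bool list \<Rightarrow> gate list \<Rightarrow> bool list" where
  "gate_values \<equiv> foldl (\<lambda>vs g. vs @ [eval_gate vs g])"

abbreviation gate_depths :: "nat \<Rightarrow> gate list \<Rightarrow> nat list" where
  "gate_depths n \<equiv> foldl (\<lambda>ds g. ds @ [Suc (Max (insert 0 ((!) ds ` set (preds g))))]) (replicate n 0)"

definition wf_gates :: "nat \<Rightarrow> gate list \<Rightarrow> bool" where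
  "wf_gates n gs \<longleftrightarrow> (\<forall>k < length gs. \<forall>w \<in> set (preds (gs ! k)). w < n + k)"

text \<open>Gates plus edges: \<open>circuit_size\<close> without the output pins. It is additive
  under concatenation.\<close>

definition gates_cost :: "gate list \<Rightarrow> nat" where
  "gates_cost gs = (\<Sum>g \<leftarrow> gs. Suc (length (preds g)))"

text \<open>The depth bound concerns the node \<open>w\<close> alone, so deeper gates elsewhere in
  \<open>gs\<close> do no harm.\<close>

definition computes :: "nat \<Rightarrow> nat \<Rightarrow> gate list \<Rightarrow> nat \<Rightarrow> (bool list \<Rightarrow> bool) \<Rightarrow> bool" where
  "computes n d gs w f \<longleftrightarrow> w < n + length gs \<and> gate_depths n gs ! w \<le> d \<and>
     (\<forall>x. length x = n \<longrightarrow> gate_values x gs ! w = f x)"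

text \<open>
  Quantifying over all circuits \<open>gs\<close> to be extended makes the notion compositional: sub-circuits
  can be appended one after another without renumbering.
\<close>

definition realizable :: "nat \<Rightarrow> nat \<Rightarrow> nat \<Rightarrow> (bool list \<Rightarrow> bool) list \<Rightarrow> bool" where
  "realizable n d s fs \<longleftrightarrow> (\<forall>gs. wf_gates n gs \<longrightarrow> (\<exists>hs ws. wf_gates n (gs @ hs) \<and>
     gates_cost hs \<le> s \<and> set (gate_depths n (gs @ hs)) \<subseteq> set (gate_depths n gs) \<union> {..d} \<and>
     list_all2 (computes n d (gs @ hs)) ws fs))"

lemma length_foldl_snoc [simp]:
  "length (foldl (\<lambda>vs g. vs @ [h vs g]) xs gs) = length xs + length gs"
  by (induction gs arbitrary: xs) auto

text \<open>With \<open>h\<close> abstract, this covers both \<open>gate_values\<close> and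
  \<open>gate_depths\<close>.\<close>

lemma nth_foldl_snoc:
  "w < length xs \<Longrightarrow> foldl (\<lambda>vs g. vs @ [h vs g]) xs gs ! w = xs ! w"
  by (induction gs arbitrary: xs) (auto simp: nth_append)

lemma computes_append:
  assumes "computes n d gs w f"
  shows "computes n d (gs @ hs) w f"
  using assms unfolding computes_def
  by (auto simp: nth_foldl_snoc)

lemma computes_mono:
  "computes n d gs w f \<Longrightarrow> d \<le> d' \<Longrightarrow> computes n d' gs w f"
  by (auto simp: computes_def)

lemma realizable_mono:
  assumes "realizable n d s fs" "d \<le> d'" "s \<le> s'"
  shows "realizable n d' s' fs"
  unfolding realizable_def
proof (intro allI impI)
  fix gs assume "wf_gates n gs"
  then obtain hs ws where h: "wf_gates n (gs @ hs)" "gates_cost hs \<le> s"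
    "set (gate_depths n (gs @ hs)) \<subseteq> set (gate_depths n gs) \<union> {..d}"
    "list_all2 (computes n d (gs @ hs)) ws fs"
    using assms(1) unfolding realizable_def by blast
  have "list_all2 (computes n d' (gs @ hs)) ws fs"
    using h(4) assms(2) by (auto elim!: list_all2_mono intro: computes_mono)
  moreover have "set (gate_depths n (gs @ hs)) \<subseteq> set (gate_depths n gs) \<union> {..d'}"
    using h(3) assms(2) by (meson Un_mono atMost_subset_iff order_refl subset_trans)
  ultimately show "\<exists>hs ws. wf_gates n (gs @ hs) \<and> gates_cost hs \<le> s' \<and>
      set (gate_depths n (gs @ hs)) \<subseteq> set (gate_depths n gs) \<union> {..d'} \<and>
      list_all2 (computes n d' (gs @ hs)) ws fs"
    using h(1,2) assms(3) le_trans by blast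
qed

section \<open>Closure properties of realizable lists\<close>

lemma realizable_Nil: "realizable n d s []"
  unfolding realizable_def by (auto intro!: exI[of _ "[]"] simp: gates_cost_def)

lemma realizable_input:
  assumes "i < n"
  shows "realizable n d s [\<lambda>x. x ! i]"
  unfolding realizable_def
proof (intro allI impI)
  fix gs assume "wf_gates n gs"
  moreover have "computes n d gs i (\<lambda>x. x ! i)"
    using assms by (simp add: computes_def nth_foldl_snoc)
  ultimately show "\<exists>hs ws. wf_gates n (gs @ hs) \<and> gates_cost hs \<le> s \<and>
      set (gate_depths n (gs @ hs)) \<subseteq> set (gate_depths n gs) \<union> {..d} \<and>
      list_all2 (computes n d (gs @ hs)) ws [\<lambda>x. x ! i]"
    by (intro exI[of _ "[]"] exI[of _ "[i]"]) (auto simp: gates_cost_def)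
qed

text \<open>The gates for \<open>fs\<close> are appended after those for \<open>f\<close>. Sizes add
  but depths do not: \<open>d\<close> bounds every new gate, whatever precedes it.\<close>

lemma realizable_Cons:
  assumes "realizable n d s [f]" "realizable n d t fs"
  shows "realizable n d (s + t) (f # fs)"
  unfolding realizable_def
proof (intro allI impI)
  fix gs assume "wf_gates n gs"
  then obtain hs vs where h: "wf_gates n (gs @ hs)" "gates_cost hs \<le> s"
    "set (gate_depths n (gs @ hs)) \<subseteq> set (gate_depths n gs) \<union> {..d}"
    "list_all2 (computes n d (gs @ hs)) vs [f]"
    using assms(1) unfolding realizable_def by blast
  from h(4) obtain w where w: "computes n d (gs @ hs) w f"
    by (auto simp: list_all2_Cons2)
  from h(1) obtain ks ws where k: "wf_gates n ((gs @ hs) @ ks)" "gates_cost ks \<le> t"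
    "set (gate_depths n ((gs @ hs) @ ks)) \<subseteq> set (gate_depths n (gs @ hs)) \<union> {..d}"
    "list_all2 (computes n d ((gs @ hs) @ ks)) ws fs"
    using assms(2) unfolding realizable_def by blast
  have "list_all2 (computes n d (gs @ hs @ ks)) (w # ws) (f # fs)"
    using k(4) computes_append[OF w, of ks] by simp
  moreover have "gates_cost (hs @ ks) \<le> s + t"
    using h(2) k(2) by (simp add: gates_cost_def)
  moreover have "set (gate_depths n (gs @ hs @ ks)) \<subseteq> set (gate_depths n gs) \<union> {..d}"
    using k(3) h(3) unfolding append_assoc by blast
  moreover have "wf_gates n (gs @ hs @ ks)"
    using k(1) by simp
  ultimately show "\<exists>hs ws. wf_gates n (gs @ hs) \<and> gates_cost hs \<le> s + t \<and>
      set (gate_depths n (gs @ hs)) \<subseteq> set (gate_depths n gs) \<union> {..d} \<and>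
      list_all2 (computes n d (gs @ hs)) ws (f # fs)"
    by blast
qed

lemma realizable_all:
  assumes "\<And>f. f \<in> set fs \<Longrightarrow> realizable n d s [f]"
  shows "realizable n d (length fs * s) fs"
  using assms by (induction fs) (auto intro: realizable_Nil realizable_Cons)

text \<open>Treats all kinds of gate at once. The length condition in \<open>preds\<close> is there
  for \<open>gate.Not (hd ws)\<close>, which reads a single predecessor.\<close>

lemma realizable_gate:
  assumes fs: "realizable n d s fs"
    and preds: "\<And>ws. length ws = length fs \<Longrightarrow> preds (G ws) = ws"
    and eval: "\<And>vs ws x. list_all2 (\<lambda>w f. vs ! w = f x) ws fs \<Longrightarrow> eval_gate vs (G ws) = f x"
  shows "realizable n (Suc d) (s + Suc (length fs)) [f]"
  unfolding realizable_def
proof (intro allI impI)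
  fix gs assume "wf_gates n gs"
  then obtain hs ws where h: "wf_gates n (gs @ hs)" "gates_cost hs \<le> s"
    "set (gate_depths n (gs @ hs)) \<subseteq> set (gate_depths n gs) \<union> {..d}"
    "list_all2 (computes n d (gs @ hs)) ws fs"
    using fs unfolding realizable_def by blast
  let ?g = "G ws"
  have preds_g: "preds ?g = ws"
    using preds h(4) list_all2_lengthD by blast
  have ws: "w < n + length (gs @ hs)" "gate_depths n (gs @ hs) ! w \<le> d" if "w \<in> set ws" for w
    using that h(4) unfolding computes_def
    by (metis (no_types, lifting) in_set_conv_nth list_all2_conv_all_nth)+
  let ?D = "Suc (Max (insert 0 ((!) (gate_depths n (gs @ hs)) ` set (preds ?g))))"
  have depth: "?D \<le> Suc d"
    using ws(2) by (auto simp del: foldl_append simp: preds_g)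
  have depths: "gate_depths n (gs @ hs @ [?g]) = gate_depths n (gs @ hs) @ [?D]"
    by simp
  have vals: "gate_values x (gs @ hs @ [?g]) =
      gate_values x (gs @ hs) @ [eval_gate (gate_values x (gs @ hs)) ?g]" for x
    by simp
  have "wf_gates n (gs @ hs @ [?g])"
    using h(1) ws(1) unfolding wf_gates_def append_assoc[symmetric]
    by (auto simp: nth_append preds_g less_Suc_eq)
  moreover have "gates_cost (hs @ [?g]) \<le> s + Suc (length fs)"
    using h(2) list_all2_lengthD[OF h(4)] by (simp add: gates_cost_def preds_g)
  moreover have "set (gate_depths n (gs @ hs @ [?g])) \<subseteq> set (gate_depths n gs) \<union> {..Suc d}"
    using h(3) depth unfolding depths by force
  moreover have "computes n (Suc d) (gs @ hs @ [?g]) (n + length (gs @ hs)) f"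
    unfolding computes_def
  proof (intro conjI allI impI)
    show "gate_depths n (gs @ hs @ [?g]) ! (n + length (gs @ hs)) \<le> Suc d"
      unfolding depths using depth by (simp add: nth_append del: foldl_append)
    fix x :: "bool list" assume x: "length x = n"
    have "list_all2 (\<lambda>w f. gate_values x (gs @ hs) ! w = f x) ws fs"
      using h(4) x by (auto elim!: list_all2_mono simp: computes_def)
    from eval[OF this] show "gate_values x (gs @ hs @ [?g]) ! (n + length (gs @ hs)) = f x"
      unfolding vals using x by (simp add: nth_append del: foldl_append)
  qed simp
  ultimately show "\<exists>hs ws. wf_gates n (gs @ hs) \<and> gates_cost hs \<le> s + Suc (length fs) \<and>
      set (gate_depths n (gs @ hs)) \<subseteq> set (gate_depths n gs) \<union> {..Suc d} \<and>
      list_all2 (computes n (Suc d) (gs @ hs)) ws [f]"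
    by (intro exI[of _ "hs @ [?g]"] exI[of _ "[n + length (gs @ hs)]"]) simp
qed

section \<open>Boolean connectives and functions of three bits\<close>

lemma realizable_Not:
  assumes "realizable n d s [f]"
  shows "realizable n (Suc d) (s + 2) [\<lambda>x. \<not> f x]"
proof -
  have "realizable n (Suc d) (s + Suc (length [f])) [\<lambda>x. \<not> f x]"
    by (rule realizable_gate[OF assms, where G = "\<lambda>ws. gate.Not (hd ws)"])
       (auto simp: list_all2_Cons2 length_Suc_conv)
  then show ?thesis
    by simp
qed

lemma realizable_And:
  assumes "realizable n d s fs"
  shows "realizable n (Suc d) (s + Suc (length fs)) [\<lambda>x. \<forall>f \<in> set fs. f x]"
  by (rule realizable_gate[OF assms, where G = And])
     (auto simp: list_all2_conv_all_nth all_set_conv_all_nth)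

lemma realizable_Or:
  assumes "realizable n d s fs"
  shows "realizable n (Suc d) (s + Suc (length fs)) [\<lambda>x. \<exists>f \<in> set fs. f x]"
proof (rule realizable_gate[OF assms, where G = Or])
  fix vs ws and x :: "bool list"
  assume "list_all2 (\<lambda>w f. vs ! w = f x) ws fs"
  then show "eval_gate vs (Or ws) = (\<exists>f \<in> set fs. f x)"
    by induction auto
qed simp

lemma realizable_const: "realizable n (Suc d) 1 [\<lambda>_. b]"
  using realizable_And[OF realizable_Nil[of n d 0]] realizable_Or[OF realizable_Nil[of n d 0]]
  by (cases b) auto

lemma realizable_and2:
  assumes "realizable n d s [f]" "realizable n d t [g]"
  shows "realizable n (Suc d) (s + t + 3) [\<lambda>x. f x \<and> g x]"
  using realizable_And[OF realizable_Cons[OF assms]] by (simp add: numeral_3_eq_3)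

lemma realizable_or2:
  assumes "realizable n d s [f]" "realizable n d t [g]"
  shows "realizable n (Suc d) (s + t + 3) [\<lambda>x. f x \<or> g x]"
  using realizable_Or[OF realizable_Cons[OF assms]] by (simp add: numeral_3_eq_3)

text \<open>A multiplexer: \<open>f\<close> selects between the restrictions of \<open>P\<close>.
  Negation, conjunction and disjunction give the three levels, and \<open>f\<close> is built
  twice.\<close>

lemma realizable_Shannon_expansion:
  assumes "realizable n d s [f]"
    and "realizable n d' t [\<lambda>x. P True x]" "realizable n d' t [\<lambda>x. P False x]"
    and "d \<le> d'"
  shows "realizable n (d' + 3) (2 * s + 2 * t + 11) [\<lambda>x. P (f x) x]"
proof -
  have f: "realizable n d' s [f]" "realizable n (Suc d') s [f]"
    using assms(1,4) by (auto intro: realizable_mono)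
  have *: "realizable n (Suc d') t [\<lambda>x. P b x]" for b
    using assms(2,3) by (cases b) (auto intro: realizable_mono)
  have "realizable n (Suc (Suc (Suc d'))) ((s + t + 3) + ((s + 2) + t + 3) + 3)
      [\<lambda>x. f x \<and> P True x \<or> \<not> f x \<and> P False x]"
    by (intro realizable_or2 realizable_and2 realizable_Not f *
        realizable_mono[OF realizable_and2[OF f(1) assms(2)]]) auto
  also have "(\<lambda>x. f x \<and> P True x \<or> \<not> f x \<and> P False x) = (\<lambda>x. P (f x) x)"
    by (metis (full_types))
  finally show ?thesis
    by (rule realizable_mono) auto
qed

text \<open>Expanding in all three arguments leaves constants, which are gates of depth 1, hence
  \<open>0 < d\<close>. Starting from cost 1, three steps from \<open>t\<close> to
  \<open>2 * s + 2 * t + 11\<close> yield \<open>14 * s + 85\<close>, within the bound.\<close>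

lemma realizable_ternary:
  assumes "realizable n d s [f]" "realizable n d s [g]" "realizable n d s [h]" "0 < d"
  shows "realizable n (d + 9) (14 * s + 91) [\<lambda>x. P (f x) (g x) (h x)]"
proof -
  have c: "realizable n d 1 [\<lambda>_. b]" for b
    using realizable_const[of n "d - 1" b] assms(4) by simp
  have 1: "realizable n (d + 3) (2 * s + 13) [\<lambda>x. P a b (h x)]" for a b
    using realizable_Shannon_expansion[where P = "\<lambda>e x. P a b e", OF assms(3) c c] by (simp add: add.commute)
  have 2: "realizable n (d + 6) (6 * s + 37) [\<lambda>x. P a (g x) (h x)]" for a
    by (rule realizable_mono[OF realizable_Shannon_expansion[where P = "\<lambda>b x. P a b (h x)", OF assms(2) 1 1]]) auto
  show ?thesis
    by (rule realizable_mono[OF realizable_Shannon_expansion[where P = "\<lambda>a x. P a (g x) (h x)", OF assms(1) 2 2]]) auto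
qed

text \<open>By non-uniformity a circuit may be chosen for each \<open>n\<close>, extending the empty
  one. The polynomial also pays for one output pin per function.\<close>

lemma AC0_I:
  fixes p :: "nat poly"
  assumes "\<And>n. realizable n d (s n) (fs n)"
    and "\<And>n. s n + length (fs n) \<le> poly p n"
    and "\<And>x. f x = map (\<lambda>h. h x) (fs (length x))"
  shows "f \<in> AC0"
proof -
  have "\<exists>C. wf_circuit C \<and> num_inputs C = n \<and> circuit_size C \<le> poly p n \<and> circuit_depth C \<le> d \<and>
      (\<forall>x. length x = n \<longrightarrow> eval_circuit C x = f x)" for n
  proof -
    have "wf_gates n []"
      by (simp add: wf_gates_def)
    then obtain hs ws where h: "wf_gates n hs" "gates_cost hs \<le> s n"
      "set (gate_depths n hs) \<subseteq> set (replicate n 0) \<union> {..d}"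
      "list_all2 (computes n d hs) ws (fs n)"
      using assms(1)[of n] unfolding realizable_def by fastforce
    let ?C = "Circuit n hs ws"
    have len: "length ws = length (fs n)"
      using h(4) by (rule list_all2_lengthD)
    have "wf_circuit ?C"
      using h(1,4) unfolding wf_circuit_def wf_gates_def
      by (fastforce simp: list_all2_conv_all_nth in_set_conv_nth computes_def)
    moreover have "circuit_size ?C \<le> poly p n"
    proof -
      have "gates_cost hs = length hs + (\<Sum>g \<leftarrow> hs. length (preds g))"
        unfolding gates_cost_def by (induction hs) auto
      then show ?thesis
        using h(2) len assms(2)[of n] by (simp add: circuit_size_def)
    qed
    moreover have "circuit_depth ?C \<le> d"
      using h(3) by (force simp: circuit_depth_def node_depths_def)
    moreover have "eval_circuit ?C x = f x" if "length x = n" for x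
      using h(4) that len
      by (auto simp: eval_circuit_def node_values_def assms(3) list_all2_conv_all_nth computes_def
          intro!: nth_equalityI)
    ultimately show ?thesis
      by (metis circuit.sel(1))
  qed
  then show ?thesis
    unfolding AC0_def by (auto intro!: exI[of _ p] exI[of _ d]) metis
qed

section \<open>The compact digits of a binary number\<close>

text \<open>Padding with zeros supplies the lookahead bit at the top position.\<close>

definition bit_at :: "bool list \<Rightarrow> nat \<Rightarrow> bool" where
  "bit_at x i \<longleftrightarrow> i < length x \<and> x ! i"

text \<open>These are the carries in adding the number to its half rounded down, whose bit
  \<open>i\<close> is \<open>bit_at x (Suc i)\<close>.\<close>

fun carry :: "bool list \<Rightarrow> nat \<Rightarrow> bool" where
  "carry x 0 = False"
| "carry x (Suc i) =
     (bit_at x i \<and> bit_at x (Suc i) \<or> carry x i \<and> (bit_at x i \<or> bit_at x (Suc i)))"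

definition digit :: "bool list \<Rightarrow> nat \<Rightarrow> int" where
  "digit x i = of_bool (bit_at x i) + of_bool (carry x i) - 2 * of_bool (carry x (Suc i))"

text \<open>The extra digit absorbs a carry at the top, as in \<open>3 = 4 - 1\<close>.\<close>

definition compact_digits :: "bool list \<Rightarrow> int list" where
  "compact_digits x = map (digit x) [0..<Suc (length x)]"

lemma carry_lookahead:
  "carry x i \<longleftrightarrow> (\<exists>j<i. bit_at x j \<and> bit_at x (Suc j) \<and>
     (\<forall>k \<in> {Suc j..<i}. bit_at x k \<or> bit_at x (Suc k)))"
proof (induction i)
  case (Suc i)
  let ?prop = "\<lambda>k. bit_at x k \<or> bit_at x (Suc k)"
  have "(\<forall>k \<in> {Suc j..<Suc i}. ?prop k) \<longleftrightarrow> (\<forall>k \<in> {Suc j..<i}. ?prop k) \<and> ?prop i" if "j < i" for j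
    using that by (auto simp: atLeastLessThanSuc)
  \<comment> \<open>Either position \<open>i\<close> generates the carry, with nothing left to
    propagate, or it propagates one generated at some \<open>j < i\<close>.\<close>
  then have "(\<exists>j<Suc i. bit_at x j \<and> bit_at x (Suc j) \<and> (\<forall>k \<in> {Suc j..<Suc i}. ?prop k)) \<longleftrightarrow>
      bit_at x i \<and> bit_at x (Suc i) \<or>
      (\<exists>j<i. bit_at x j \<and> bit_at x (Suc j) \<and> (\<forall>k \<in> {Suc j..<i}. ?prop k)) \<and> ?prop i"
    unfolding Ex_less_Suc by (simp cong: conj_cong) blast
  then show ?case
    unfolding carry.simps Suc.IH by blast
qed simp

lemma digit_cases: "digit x i \<in> {-1, 0, 1}"
  by (auto simp: digit_def)

lemma digit_mult_Suc: "digit x (Suc i) * digit x i = 0"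
  by (auto simp: digit_def)

lemma sum_digits:
  "(\<Sum>i<m. digit x i * 2 ^ i) = (\<Sum>i<m. of_bool (bit_at x i) * 2 ^ i) - of_bool (carry x m) * 2 ^ m"
  by (induction m) (auto simp: digit_def)

lemma compact_sd_problem_compact_digits:
  "compact_sd_problem enc x (encode_digits enc (compact_digits x))"
proof -
  let ?B = "compact_digits x"
  have nth: "?B ! i = digit x i" if "i < Suc (length x)" for i
    using that by (simp add: compact_digits_def del: upt_Suc)
  have len: "length ?B = Suc (length x)"
    by (simp add: compact_digits_def)
  have "signed_digit_rep ?B"
    using digit_cases by (force simp: signed_digit_rep_def compact_digits_def)
  moreover have "compact_rep ?B"
    unfolding compact_rep_def len
  proof
    fix i assume "i \<in> {1..<Suc (length x)}"
    then obtain j where "i = Suc j" "j < length x"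
      by (cases i) auto
    then show "?B ! i * ?B ! (i - 1) = 0"
      using digit_mult_Suc[of x j] by (simp add: nth)
  qed
  moreover have "sd_val ?B = bin_val x"
  proof -
    have "sd_val ?B = (\<Sum>i<Suc (length x). digit x i * 2 ^ i)"
      unfolding sd_val_def len by (intro sum.cong) (auto simp: nth)
    \<comment> \<open>The carry left over by telescoping is false: both bits in its recursion lie
      past the end.\<close>
    also have "\<dots> = (\<Sum>i<Suc (length x). of_bool (bit_at x i) * 2 ^ i)"
      unfolding sum_digits by (simp add: bit_at_def)
    also have "\<dots> = bin_val x"
      by (simp add: bin_val_def bit_at_def)
    finally show ?thesis .
  qed
  ultimately show ?thesis
    unfolding compact_sd_problem_def by blast
qed

section \<open>Circuits for the digits\<close>

text \<open>Agreement on length \<open>n\<close> suffices, so the length test in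
  \<open>bit_at\<close> can be settled when the circuit is built.\<close>

lemma realizable_cong:
  assumes "realizable n d s [f]" "\<And>x. length x = n \<Longrightarrow> f x = g x"
  shows "realizable n d s [g]"
proof -
  have "computes n d gs w f = computes n d gs w g" for gs w
    using assms(2) by (auto simp: computes_def)
  then show ?thesis
    using assms(1) by (simp add: realizable_def list_all2_Cons2)
qed

lemma realizable_bit_at: "realizable n 1 1 [\<lambda>x. bit_at x i]"
proof (cases "i < n")
  case True
  then show ?thesis
    by (intro realizable_cong[OF realizable_input[OF True]]) (simp add: bit_at_def)
next
  case False
  then show ?thesis
    using realizable_const[of n 0 False]
    by (auto elim!: realizable_cong simp: bit_at_def)
qed

text \<open>Four levels: bits, disjunctions of adjacent bits, a conjunction for each generating
  \<open>j\<close>, and a disjunction over \<open>j\<close>.\<close>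

lemma realizable_carry: "realizable n 4 (i * (6 * i + 20) + 1) [\<lambda>x. carry x i]"
proof -
  define terms where "terms = (\<lambda>j. (\<lambda>x. bit_at x j) # (\<lambda>x. bit_at x (Suc j)) #
    map (\<lambda>k x. bit_at x k \<or> bit_at x (Suc k)) [Suc j..<i])"
  have or: "realizable n 2 5 [\<lambda>x. bit_at x k \<or> bit_at x (Suc k)]" for k
    using realizable_or2[OF realizable_bit_at[of n k] realizable_bit_at[of n "Suc k"]]
    by (simp add: numeral_2_eq_2)
  have bit: "realizable n 2 5 [\<lambda>x. bit_at x k]" for k
    by (rule realizable_mono[OF realizable_bit_at]) auto
  \<comment> \<open>At most \<open>i + 2\<close> conjuncts, each of cost 5 plus an edge, and the
    gate itself: at most \<open>6 * i + 13\<close>.\<close>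
  have "realizable n 3 (6 * i + 19) [\<lambda>x. \<forall>f \<in> set (terms j). f x]" for j
  proof -
    have "realizable n 2 (length (terms j) * 5) (terms j)"
      by (rule realizable_all) (auto simp: terms_def intro: or bit)
    from realizable_And[OF this] show ?thesis
      by (rule realizable_mono) (auto simp: terms_def)
  qed
  then have "realizable n 3 (i * (6 * i + 19)) (map (\<lambda>j x. \<forall>f \<in> set (terms j). f x) [0..<i])"
    using realizable_all[of "map (\<lambda>j x. \<forall>f \<in> set (terms j). f x) [0..<i]" n 3 "6 * i + 19"] by auto
  from realizable_Or[OF this]
  have "realizable n 4 (i * (6 * i + 20) + 1)
      [\<lambda>x. \<exists>f \<in> set (map (\<lambda>j x. \<forall>f \<in> set (terms j). f x) [0..<i]). f x]"
    by (rule realizable_mono) (auto simp: algebra_simps)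
  then show ?thesis
    by (rule realizable_cong) (auto simp: carry_lookahead terms_def)
qed

text \<open>A digit is a function of three bits of depth at most 4, and
  \<open>realizable_ternary\<close> adds 9. As \<open>P\<close> is arbitrary, either bit of any
  encoding is covered.\<close>

lemma realizable_digit:
  assumes "i \<le> n"
  shows "realizable n 13 (14 * ((n + 1) * (6 * n + 26) + 1) + 91) [\<lambda>x. P (digit x i)]"
proof -
  have carry: "realizable n 4 ((n + 1) * (6 * n + 26) + 1) [\<lambda>x. carry x j]" if "j \<le> n + 1" for j
  proof (rule realizable_mono[OF realizable_carry])
    \<comment> \<open>The largest carry index is \<open>n + 1\<close>, and
      \<open>6 * (n + 1) + 20 = 6 * n + 26\<close>.\<close>
    have "j * (6 * j + 20) \<le> (n + 1) * (6 * n + 26)"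
      using that by (intro mult_mono) auto
    then show "j * (6 * j + 20) + 1 \<le> (n + 1) * (6 * n + 26) + 1"
      by simp
  qed simp
  have bit: "realizable n 4 ((n + 1) * (6 * n + 26) + 1) [\<lambda>x. bit_at x i]"
    by (rule realizable_mono[OF realizable_bit_at]) auto
  have "realizable n (4 + 9) (14 * ((n + 1) * (6 * n + 26) + 1) + 91)
      [\<lambda>x. P (of_bool (bit_at x i) + of_bool (carry x i) - 2 * of_bool (carry x (Suc i)))]"
    by (intro realizable_ternary[where P = "\<lambda>a c c'. P (of_bool a + of_bool c - 2 * of_bool c')"]
        carry bit) (use assms in auto)
  then show ?thesis
    unfolding digit_def by simp
qed

lemma encode_compact_digits_in_AC0: "(\<lambda>x. encode_digits enc (compact_digits x)) \<in> AC0"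
proof -
  define fs :: "nat \<Rightarrow> (bool list \<Rightarrow> bool) list" where
    "fs = (\<lambda>n. concat (map (\<lambda>i. [\<lambda>x. fst (enc (digit x i)), \<lambda>x. snd (enc (digit x i))]) [0..<Suc n]))"
  define t :: "nat \<Rightarrow> nat" where "t = (\<lambda>n. 14 * ((n + 1) * (6 * n + 26) + 1) + 91)"
  have len: "length (fs n) = 2 * (n + 1)" for n
    by (simp add: fs_def length_concat comp_def sum_list_triv del: upt_Suc)
  show ?thesis
  proof (rule AC0_I)
    fix n
    show "realizable n 13 (length (fs n) * t n) (fs n)"
    proof (rule realizable_all)
      have "realizable n 13 (t n) [\<lambda>x. P (digit x i)]" if "i < Suc n" for i P
        unfolding t_def using that by (intro realizable_digit) simp
      then show "realizable n 13 (t n) [f]" if "f \<in> set (fs n)" for f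
        using that by (auto simp: fs_def simp del: upt_Suc)
    qed
    \<comment> \<open>The value is \<open>2 * (n + 1) * (t n + 1)\<close>: each output function
      costs \<open>t n\<close> and a pin.\<close>
    show "length (fs n) * t n + length (fs n) \<le>
        poly (2 * [:1, 1:] * (14 * ([:1, 1:] * [:26, 6:] + 1) + 92)) n"
      by (simp add: len t_def algebra_simps)
  next
    fix x
    show "encode_digits enc (compact_digits x) = map (\<lambda>h. h x) (fs (length x))"
      by (simp add: encode_digits_def compact_digits_def fs_def map_concat comp_def del: upt_Suc)
  qed
qed

theorem theorem12:
  fixes enc :: "int \<Rightarrow> bool \<times> bool"
  assumes "inj_on enc {-1, 0, 1}"
  shows "problem_in_AC0 (compact_sd_problem enc)"
  unfolding problem_in_AC0_def
  by (intro bexI allI) (rule compact_sd_problem_compact_digits encode_compact_digits_in_AC0)+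

end
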